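(* Let $w,u$ be words over $\{0,1\}$ of the same length $\ell\ge2$. Every cycle of the permutations $S_0(w)$ and $S_1(w)$ of $\{0,1\}^\ell$ has length a power of $2$. Furthermore, for all $a,b,c\in\{0,1\}$, either $\Lambda_c(aw)(bu)=\Lambda_c(w)(u)$ or $\Lambda_c(aw)(bu)=2\Lambda_c(w)(u)$.
   Context: For words $w=w_1\cdots w_\ell$, $u=u_1\cdots u_\ell$ over $\{0,1\}$ and $a\in\{0,1\}$, $S_a(w)(u)\in\{0,1\}^\ell$ is the word with $\ell$-th letter $u_\ell$ and $i$-th letter $u_i\oplus(u_{i+1}\wedge[w_{i+1}=a])$ for $1\le i\le\ell-1$ ($[\cdot]$ the indicator; $\oplus,\wedge$ XOR/AND). $S_a(w)$ is a bijection of $\{0,1\}^\ell$. $\Lambda_a(w)(u)$ denotes the length of the cycle of $S_a(w)$ containing $u$, i.e. the least $m\ge1$ with $S_a(w)^m(u)=u$. For letters $a,b$, $aw$ and $bu$ denote concatenation. *)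

theory Defs
  imports "HOL-Library.Z2" "HOL-Combinatorics.Cycles"
begin

text \<open>Words over \<open>{0,1}\<close> are lists over \<^typ>\<open>bit\<close>, the field with two elements: there \<open>+\<close> is XOR and
  \<open>*\<close> is AND. Lists are indexed from 0, so the i-th letter of \<open>u\<close> is \<open>u ! (i - 1)\<close>.\<close>

definition words :: "nat \<Rightarrow> bit list set" where
  "words l = {u. length u = l}"

text \<open>Only meaningful for \<open>length w = length u\<close>.\<close>

definition S :: "bit \<Rightarrow> bit list \<Rightarrow> bit list \<Rightarrow> bit list" where
  "S a w u = map (\<lambda>i. if Suc i < length u
                       then u ! i + u ! Suc i * of_bool (w ! Suc i = a)
                       else u ! i) [0..<length u]"

text \<open>\<^const>\<open>least_power\<close> \<open>f x\<close> is the least \<open>m > 0\<close> with \<open>(f ^^ m) x = x\<close>.\<close>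

definition \<Lambda> :: "bit \<Rightarrow> bit list \<Rightarrow> bit list \<Rightarrow> nat" where
  "\<Lambda> a w u = least_power (S a w) u"

lemma length_S [simp]: "length (S a w u) = length u"
  by (simp add: S_def)

lemma S_nth: "i < length u \<Longrightarrow>
  S a w u ! i = (if Suc i < length u then u ! i + u ! Suc i * of_bool (w ! Suc i = a) else u ! i)"
  by (simp add: S_def)

lemma finite_words: "finite (words l)"
proof -
  have "finite (UNIV :: bit set)"
    by (rule finite_subset[of _ "{0, 1}"]) (auto intro: bit.exhaust)
  from finite_lists_length_eq[OF this] show ?thesis
    by (simp add: words_def)
qed

lemma bij_betw_S: "bij_betw (S a w) (words l) (words l)"
proof -
  have "inj_on (S a w) (words l)"
  proof (rule inj_onI)
    fix u v assume uv: "u \<in> words l" "v \<in> words l" and eq: "S a w u = S a w v"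
    then have len: "length u = l" "length v = l" by (auto simp: words_def)
    have "k < l \<Longrightarrow> u ! (l - Suc k) = v ! (l - Suc k)" for k
    proof (induction k)
      case 0
      then show ?case
        using S_nth[of "l - 1" u a w] S_nth[of "l - 1" v a w] eq len by simp
    next
      case (Suc k)
      let ?i = "l - Suc (Suc k)"
      have i: "Suc ?i = l - Suc k" "?i < l" "Suc ?i < l" using Suc.prems by auto
      have "u ! ?i + u ! Suc ?i * of_bool (w ! Suc ?i = a) = v ! ?i + v ! Suc ?i * of_bool (w ! Suc ?i = a)"
        using S_nth[of ?i u a w] S_nth[of ?i v a w] eq len i by (simp del: add_bit_eq_xor)
      moreover have "u ! Suc ?i = v ! Suc ?i" using Suc i by simp
      ultimately show ?case by (metis add_right_cancel)
    qed
    note last = this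
    have "u ! i = v ! i" if "i < l" for i
    proof -
      have "l - Suc (l - Suc i) = i" "l - Suc i < l" using that by auto
      then show ?thesis using last[of "l - Suc i"] by simp
    qed
    then show "u = v" using len by (simp add: list_eq_iff_nth_eq)
  qed
  moreover have "S a w ` words l \<subseteq> words l" by (auto simp: words_def)
  ultimately show ?thesis
    by (simp add: bij_betw_def endo_inj_surj finite_words)
qed

lemma \<Lambda>_returns:
  assumes "length u = length w"
  shows "\<Lambda> a w u \<ge> 1" "(S a w ^^ \<Lambda> a w u) u = u"
    "\<And>m. 1 \<le> m \<Longrightarrow> (S a w ^^ m) u = u \<Longrightarrow> \<Lambda> a w u \<le> m"
proof -
  let ?f = "S a w" and ?A = "words (length w)"
  have u: "u \<in> ?A" using assms by (simp add: words_def)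
  have bij: "bij_betw (?f ^^ n) ?A ?A" for n
    by (rule bij_betw_funpow[OF bij_betw_S])
  have "\<not> inj_on (\<lambda>n. (?f ^^ n) u) UNIV"
  proof
    assume "inj_on (\<lambda>n. (?f ^^ n) u) UNIV"
    moreover have "range (\<lambda>n. (?f ^^ n) u) \<subseteq> ?A"
      using bij_betwE[OF bij] u by blast
    ultimately show False
      using finite_words finite_subset finite_imageD infinite_UNIV_nat by blast
  qed
  then obtain m n where "m < n" and mn: "(?f ^^ m) u = (?f ^^ n) u"
    unfolding inj_on_def by (metis linorder_neqE_nat)
  from mn \<open>m < n\<close> have "(?f ^^ m) u = (?f ^^ m) ((?f ^^ (n - m)) u)"
    using funpow_add[of m "n - m" ?f] by simp
  moreover have "(?f ^^ (n - m)) u \<in> ?A" using bij_betwE[OF bij] u by blast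
  ultimately have "(?f ^^ (n - m)) u = u"
    using inj_onD[OF bij_betw_imp_inj_on[OF bij]] u by metis
  then have ex: "\<exists>k. (?f ^^ k) u = u \<and> k > 0" using \<open>m < n\<close> by (intro exI[of _ "n - m"]) simp
  from LeastI_ex[OF ex] show "\<Lambda> a w u \<ge> 1" "(?f ^^ \<Lambda> a w u) u = u"
    by (simp_all add: \<Lambda>_def least_power_def)
  show "\<And>m. 1 \<le> m \<Longrightarrow> (?f ^^ m) u = u \<Longrightarrow> \<Lambda> a w u \<le> m"
    unfolding \<Lambda>_def least_power_def by (rule Least_le) simp
qed

end

theory Submission
  imports Defs
begin

text \<open>Prepending letters to \<open>w\<close> and \<open>u\<close> leaves the action on the tail unchanged, and the new first letter
  is only shifted by an amount depending on the tail. So after one full period \<open>p\<close> of the tail the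
  first letter has changed by a constant \<open>d\<close>, and after \<open>2 * p\<close> steps by \<open>d + d = 0\<close>.\<close>

text \<open>An empty tail gives shift 0 because the new letter is then the last one, which
  \<open>S\<close> fixes. The letter prepended to \<open>w\<close> does not enter, since
  \<open>S\<close> never reads the first letter of its control word.\<close>

definition head_shift :: "bit \<Rightarrow> bit list \<Rightarrow> bit list \<Rightarrow> bit" where
  "head_shift c w u = (if u = [] then 0 else hd u * of_bool (w ! 0 = c))"

lemma S_Cons: "S c (a # w) (b # u) = (b + head_shift c w u) # S c w u"
proof (rule nth_equalityI)
  fix i
  assume "i < length (S c (a # w) (b # u))"
  then show "S c (a # w) (b # u) ! i = ((b + head_shift c w u) # S c w u) ! i"
    by (cases i) (auto simp: S_nth head_shift_def hd_conv_nth simp del: add_bit_eq_xor)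
qed simp

text \<open>The accumulated shift depends on the orbit of the tail only, not on
  \<open>b\<close>.\<close>

lemma S_funpow_Cons:
  "(S c (a # w) ^^ n) (b # u) =
    (b + (\<Sum>i<n. head_shift c w ((S c w ^^ i) u))) # (S c w ^^ n) u"
  by (induction n) (simp_all add: S_Cons add.assoc del: add_bit_eq_xor)

text \<open>The remainder of \<open>n\<close> modulo the period is again a return time, so
  minimality forces it to be 0.\<close>

lemma \<Lambda>_dvd:
  assumes "length u = length w" and "(S c w ^^ n) u = u"
  shows "\<Lambda> c w u dvd n"
proof -
  have "(S c w ^^ (n mod \<Lambda> c w u)) u = u"
    using funpow_mod_eq[OF \<Lambda>_returns(2)[OF assms(1)]] assms(2) by simp
  moreover have "n mod \<Lambda> c w u < \<Lambda> c w u"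
    using \<Lambda>_returns(1)[OF assms(1), of c] by simp
  ultimately have "n mod \<Lambda> c w u = 0"
    using \<Lambda>_returns(3)[OF assms(1), of "n mod \<Lambda> c w u" c] by linarith
  then show ?thesis by presburger
qed

lemma \<Lambda>_Cons:
  assumes len: "length u = length w"
  shows "\<Lambda> c (a # w) (b # u) = \<Lambda> c w u \<or> \<Lambda> c (a # w) (b # u) = 2 * \<Lambda> c w u"
proof -
  define p q where "p = \<Lambda> c w u" and "q = \<Lambda> c (a # w) (b # u)"
  define d where "d = (\<Sum>i<p. head_shift c w ((S c w ^^ i) u))"
  have len': "length (b # u) = length (a # w)" using len by simp
  \<comment> \<open>Stated for every first letter \<open>x\<close>, so that it applies twice in a
    row.\<close>
  have step: "(S c (a # w) ^^ p) (x # u) = (x + d) # u" for x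
    using \<Lambda>_returns(2)[OF len, of c] by (simp add: S_funpow_Cons p_def d_def del: add_bit_eq_xor)
  have "(S c (a # w) ^^ (2 * p)) (b # u) = (b + d + d) # u"
    by (simp add: mult_2 funpow_add step del: add_bit_eq_xor)
  also have "b + d + d = b" by (cases d) simp_all
  finally have "q dvd 2 * p"
    unfolding q_def using \<Lambda>_dvd[OF len'] by blast
  \<comment> \<open>A return of \<open>b # u\<close> is in particular a return of its tail.\<close>
  moreover have "(S c w ^^ q) u = u"
    using \<Lambda>_returns(2)[OF len', of c] by (simp add: S_funpow_Cons q_def)
  then have "p dvd q"
    unfolding p_def by (rule \<Lambda>_dvd[OF len])
  moreover have "p > 0"
    using \<Lambda>_returns(1)[OF len, of c] by (simp add: p_def)
  ultimately obtain k where k: "q = p * k" "k dvd 2"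
    by (metis dvd_def mult.commute nat_mult_dvd_cancel1)
  \<comment> \<open>The value 0 is excluded because 0 does not divide 2.\<close>
  then have "k = 1 \<or> k = 2"
    using dvd_imp_le[of k 2] by (cases k) auto
  with k show ?thesis by (auto simp: p_def q_def)
qed

text \<open>The empty word has period 1, and each prepended letter keeps or doubles the
  period.\<close>

lemma \<Lambda>_power_of_2:
  assumes "length u = length w"
  shows "\<exists>k. \<Lambda> c w u = 2 ^ k"
  using assms
proof (induction u w rule: list_induct2)
  case Nil
  have "\<Lambda> c [] [] dvd 1" by (rule \<Lambda>_dvd) (simp_all add: S_def)
  then show ?case by (intro exI[of _ 0]) simp
next
  case (Cons b u a w)
  then obtain k where "\<Lambda> c w u = 2 ^ k" by blast
  then show ?case
    using \<Lambda>_Cons[OF Cons.hyps, of c a b] by (metis power_Suc)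
qed

theorem theorem6p2:
  fixes w u :: "bit list" and l :: nat
  assumes "l \<ge> 2" and "w \<in> words l" and "u \<in> words l"
  shows "(\<forall>c. \<forall>v \<in> words l. \<exists>k. \<Lambda> c w v = 2 ^ k) \<and>
    (\<forall>a b c. \<Lambda> c (a # w) (b # u) = \<Lambda> c w u \<or> \<Lambda> c (a # w) (b # u) = 2 * \<Lambda> c w u)"
  using assms(2,3) by (simp add: words_def \<Lambda>_power_of_2 \<Lambda>_Cons)

end
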